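(* Let $g:\mathbb{R}^m\to\mathbb{R}$ be a convex Fréchet differentiable function with $L_g$-Lipschitz continuous gradient, and assume that $\operatorname{argmin} g\neq\emptyset$. Let $t_0>0$, $u_0,v_0\in\mathbb{R}^m$, $\alpha>3$, $\gamma>0$ and $\beta\in\mathbb{R}$. Let $x:[t_0,+\infty)\to\mathbb{R}^m$ be the unique strong global solution of the dynamical system $$\ddot{x}(t)+\frac{\alpha}{t}\dot{x}(t)+\nabla g\left(x(t)+\left(\gamma+\frac{\beta}{t}\right)\dot{x}(t)\right)=0,\qquad x(t_0)=u_0,\ \dot{x}(t_0)=v_0.$$ Then $x$ is bounded and there exist $K\ge 0$ and $t_1\ge t_0$ such that $$\|\dot{x}(t)\|\le\frac{K}{t}\quad\text{for all }t\ge t_1.$$ Further, $$\int_{t_0}^{+\infty}t\|\dot{x}(t)\|^2\,dt<+\infty,$$ and there exist $K_1\ge 0$ and $t_2\ge t_0$ such that $$g(x(t))-\min g\le\frac{K_1}{t^2}\quad\text{for all }t\ge t_2.$$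
   Context: $\mathbb{R}^m$ carries the Euclidean norm $\|\cdot\|$. That $\nabla g$ is $L_g$-Lipschitz means $L_g\ge 0$ and $\|\nabla g(x)-\nabla g(y)\|\le L_g\|x-y\|$ for all $x,y\in\mathbb{R}^m$. A function $x:[t_0,+\infty)\to\mathbb{R}^m$ is a strong global solution of the dynamical system if: (i) $x$ and $\dot x$ are locally absolutely continuous on $[t_0,+\infty)$ (i.e. absolutely continuous on every compact interval $[t_0,T]$, $T>t_0$); (ii) the differential equation holds for almost every $t\ge t_0$; (iii) $x(t_0)=u_0$ and $\dot x(t_0)=v_0$. Under the stated assumptions such a solution exists and is unique. *)

theory Defs
  imports "HOL-Analysis.Analysis"
begin

(* The usual epsilon-delta definition, for functions on a real interval. The elements of a
   division d are finitely many nonoverlapping closed intervals {a..b}, for which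
   Inf k = a and Sup k = b. The library constant absolutely_continuous
   is the unrelated notion for measures. *)
definition abs_continuous_on :: "real set \<Rightarrow> (real \<Rightarrow> 'a::real_normed_vector) \<Rightarrow> bool" where
  "abs_continuous_on S f \<longleftrightarrow>
     (\<forall>\<epsilon>>0. \<exists>\<delta>>0. \<forall>d. d division_of \<Union>d \<and> \<Union>d \<subseteq> S \<and> (\<Sum>k\<in>d. Sup k - Inf k) < \<delta>
        \<longrightarrow> (\<Sum>k\<in>d. norm (f (Sup k) - f (Inf k))) < \<epsilon>)"

definition locally_abs_continuous_from :: "real \<Rightarrow> (real \<Rightarrow> 'a::real_normed_vector) \<Rightarrow> bool" where
  "locally_abs_continuous_from t0 f \<longleftrightarrow> (\<forall>T>t0. abs_continuous_on {t0..T} f)"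

(* G is the gradient of the objective. Functions on [t0, oo) are total functions whose values
   left of t0 are irrelevant; x' is the velocity, determined by x on {t0..} through the first
   conjunct (the derivative is one-sided at t0). *)
definition strong_global_solution ::
  "('a::euclidean_space \<Rightarrow> 'a) \<Rightarrow> real \<Rightarrow> real \<Rightarrow> real \<Rightarrow> real \<Rightarrow> 'a \<Rightarrow> 'a
    \<Rightarrow> (real \<Rightarrow> 'a) \<Rightarrow> (real \<Rightarrow> 'a) \<Rightarrow> bool" where
  "strong_global_solution G \<alpha> \<beta> \<gamma> t0 u0 v0 x x' \<longleftrightarrow>
     (\<forall>t\<ge>t0. (x has_vector_derivative x' t) (at t within {t0..})) \<and>
     locally_abs_continuous_from t0 x \<and>
     locally_abs_continuous_from t0 x' \<and>
     (AE t in lebesgue. t \<ge> t0 \<longrightarrow>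
        (\<exists>x''. (x' has_vector_derivative x'') (at t within {t0..}) \<and>
           x'' + (\<alpha> / t) *\<^sub>R x' t + G (x t + (\<gamma> + \<beta> / t) *\<^sub>R x' t) = 0)) \<and>
     x t0 = u0 \<and> x' t0 = v0"

end

(* The argument rests on the energy
     E(t) = t^2 (g(y) - min g) + 1/2 |l (x - p) + t x'|^2 + l (\<alpha> - 1 - l)/2 |x - p|^2,
   where y = x + (\<gamma> + \<beta>/t) x', p is a minimizer and l = (\<alpha> + 1)/2 lies strictly between 2 and \<alpha> - 1.
   Since y' contains \<gamma> x'', the derivative of t^2 g(y) produces the dissipative term
   - \<gamma> t^2 |G(y)|^2, which for large t absorbs the cross term of order t between x' and G(y). Hence
   E' <= - (\<alpha> - 3)/4 t |x'|^2 eventually, and boundedness, the velocity bound and the integral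
   estimate follow. The rate for g(y) passes to g(x) because |x - y| = O(1/t) and
   |G(y)|^2 <= 4 L (g(y) - min g) = O(1/t^2). *)
theory Submission
  imports Defs
begin

section \<open>Absolute continuity and the fundamental theorem of calculus\<close>

lemma abs_continuous_onE:
  assumes "abs_continuous_on S f" "\<epsilon> > 0"
  obtains \<delta> where "\<delta> > 0"
    "\<And>D. \<lbrakk>D division_of \<Union>D; \<Union>D \<subseteq> S; (\<Sum>k\<in>D. Sup k - Inf k) < \<delta>\<rbrakk>
      \<Longrightarrow> (\<Sum>k\<in>D. norm (f (Sup k) - f (Inf k))) < \<epsilon>"
proof -
  from assms obtain \<delta> where "\<delta> > 0" and
    *: "\<forall>D. D division_of \<Union>D \<and> \<Union>D \<subseteq> S \<and> (\<Sum>k\<in>D. Sup k - Inf k) < \<delta>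
        \<longrightarrow> (\<Sum>k\<in>D. norm (f (Sup k) - f (Inf k))) < \<epsilon>"
    unfolding abs_continuous_on_def by auto
  show thesis
    by (rule that[OF \<open>\<delta> > 0\<close>], rule *[rule_format], intro conjI)
qed

text \<open>Tags in the exceptional null set \<open>N\<close> get intervals inside an open set of small measure, where
  absolute continuity bounds the increments of \<open>f\<close>; the other tags are treated as for a function
  differentiable everywhere.\<close>
lemma abs_continuous_on_FTC:
  fixes f f' :: "real \<Rightarrow> 'a::banach"
  assumes ac: "abs_continuous_on {a..b} f" and ab: "a \<le> b"
    and ae: "AE t in lebesgue. t \<in> {a..b} \<longrightarrow> (f has_vector_derivative f' t) (at t within {a..b})"
  shows "(f' has_integral f b - f a) {a..b}"
proof (cases "a = b")
  case True
  then show ?thesis by (simp add: has_integral_refl)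
next
  case False
  with ab have "a < b" by simp
  then have "a \<le> b" by simp
  from ae obtain N where N: "N \<in> null_sets lebesgue"
    and deriv: "\<And>t. t \<in> {a..b} \<Longrightarrow> t \<notin> N \<Longrightarrow> (f has_vector_derivative f' t) (at t within {a..b})"
    by (auto elim!: AE_E3)
  \<comment> \<open>With value zero on \<open>N\<close>, a tag there contributes only the increment
    of \<open>f\<close> to the error, however large \<open>f'\<close> may be. Changing a null set
    does not affect the integral, so \<open>f'\<close> is restored at the end.\<close>
  define h where "h = (\<lambda>t. if t \<in> N then 0 else f' t)"
  have "(h has_integral f b - f a) {a..b}"
    unfolding has_integral_factor_content box_real[symmetric]
  proof safe
    fix e0 :: real
    assume "e0 > 0"
    show "\<exists>d. gauge d \<and> (\<forall>p. p tagged_division_of (cbox a b) \<and> d fine p \<longrightarrow>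
      norm ((\<Sum>(x, k)\<in>p. measure lborel k *\<^sub>R h x) - (f b - f a)) \<le> e0 * measure lborel (cbox a b))"
    proof -
      \<comment> \<open>One half of the error is for the tags in \<open>N\<close>, the other for the
        remaining tags.\<close>
      define e where "e = e0 / 2"
      have "e > 0" using \<open>e0 > 0\<close> by (simp add: e_def)
      then have "e * (b - a) > 0" using \<open>a < b\<close> by simp
      then obtain \<delta> where "\<delta> > 0" and \<delta>: "\<And>D. \<lbrakk>D division_of \<Union>D; \<Union>D \<subseteq> {a..b}; (\<Sum>k\<in>D. Sup k - Inf k) < \<delta>\<rbrakk>
          \<Longrightarrow> (\<Sum>k\<in>D. norm (f (Sup k) - f (Inf k))) < e * (b - a)"
        using abs_continuous_onE[OF ac] by blast
      have "N \<in> sets lebesgue" using N by auto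
      \<comment> \<open>Outer regularity puts the null set inside an open set of measure less than
        \<open>\<delta>\<close>.\<close>
      from sets_lebesgue_outer_open[OF this \<open>\<delta> > 0\<close>] obtain U where U: "open U" "N \<subseteq> U"
        "U - N \<in> lmeasurable" "emeasure lebesgue (U - N) < ennreal \<delta>" by metis
      have Um: "U \<in> lmeasurable" "measure lebesgue U < \<delta>"
      proof -
        have "N \<in> lmeasurable" using N by (simp add: fmeasurable_def null_sets_def)
        then have "(U - N) \<union> N \<in> lmeasurable" using U by (intro fmeasurable.Un)
        moreover have "(U - N) \<union> N = U" using U by auto
        ultimately show "U \<in> lmeasurable" by simp
        have "measure lebesgue ((U - N) \<union> N) = measure lebesgue (U - N)"
          using U N by (intro measure_Un_null_set) auto
        moreover have "measure lebesgue (U - N) < \<delta>"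
          using U(3,4) \<open>\<delta> > 0\<close> by (simp add: emeasure_eq_measure2 ennreal_less_iff)
        ultimately show "measure lebesgue U < \<delta>"
          using \<open>(U - N) \<union> N = U\<close> by simp
      qed
      \<comment> \<open>The radius of the gauge at \<open>x\<close>. The two demands concern
        disjoint sets of points, so each point has to meet only one of them.\<close>
      have "\<exists>d>0. (x \<in> N \<longrightarrow> ball x d \<subseteq> U) \<and> (x \<in> {a..b} - N \<longrightarrow>
         (\<forall>y\<in>{a..b}. norm (y-x) < d \<longrightarrow> norm (f y - f x - (y-x) *\<^sub>R f' x) \<le> e * norm (y-x)))" for x
      proof (cases "x \<in> N")
        case True
        then show ?thesis using U openE by (metis Diff_iff subsetD)
      next
        case False
        show ?thesis
        proof (cases "x \<in> {a..b}")
          case True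
          with deriv[OF True False] \<open>e > 0\<close> False show ?thesis
            unfolding has_vector_derivative_def has_derivative_within_alt by blast
        qed (use False in \<open>auto intro: exI[of _ 1]\<close>)
      qed
      then obtain d where d: "\<And>x. 0 < d x" "\<And>x. x \<in> N \<Longrightarrow> ball x (d x) \<subseteq> U"
         "\<And>x y. \<lbrakk>x \<in> {a..b}; x \<notin> N; y \<in> {a..b}; norm (y-x) < d x\<rbrakk>
             \<Longrightarrow> norm (f y - f x - (y-x) *\<^sub>R f' x) \<le> e * norm (y-x)"
        by (metis Diff_iff)
      show ?thesis
      proof (rule exI, safe)
        show "gauge (\<lambda>x. ball x (d x))"
          using d(1) gauge_ball_dependent by blast
      next
        fix p
        assume p: "p tagged_division_of cbox a b" and fine: "(\<lambda>x. ball x (d x)) fine p"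
        have ba: "b - a = (\<Sum>(x,K)\<in>p. Sup K - Inf K)" "f b - f a = (\<Sum>(x,K)\<in>p. f(Sup K) - f(Inf K))"
          using additive_tagged_division_1[where f= "\<lambda>x. x"] additive_tagged_division_1[where f= f]
            \<open>a \<le> b\<close> p by auto
        have fin: "finite p" using p by blast
        define q where "q = {(x,K). (x,K) \<in> p \<and> x \<in> N}"
        have qp: "q \<subseteq> p" by (auto simp: q_def)
        have q: "q tagged_division_of \<Union>(snd ` q)"
          using p qp by (meson tagged_division_of_def tagged_partial_division_of_Union_self tagged_partial_division_subset)
        have D: "snd ` q division_of \<Union>(snd ` q)"
          using division_of_tagged_division[OF q] .
        have interval: "\<exists>u v. K = {u..v} \<and> u \<le> v \<and> Sup K = v \<and> Inf K = u \<and> x \<in> {u..v} \<and> {u..v} \<subseteq> {a..b} \<and> {u..v} \<subseteq> ball x (d x)"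
          if "(x, K) \<in> p" for x K
        proof -
          have "x \<in> K" "K \<subseteq> cbox a b" "\<exists>u v. K = cbox u v"
            using p that by blast+
          then obtain u v where "K = {u..v}" by auto
          moreover have "K \<subseteq> ball x (d x)" using fine that by blast
          ultimately show ?thesis using \<open>x \<in> K\<close> \<open>K \<subseteq> cbox a b\<close> by auto
        qed
        have *: "K \<subseteq> {a..b} \<and> K \<subseteq> U \<and> Sup K - Inf K = measure lborel K" if "K \<in> snd ` q" for K
        proof -
          obtain x where "(x, K) \<in> p" "x \<in> N" using \<open>K \<in> snd ` q\<close> by (auto simp: q_def)
          with interval d(2) obtain u v where "K = {u..v}" "u \<le> v" "{u..v} \<subseteq> {a..b}" "{u..v} \<subseteq> U"
            by (meson subset_trans)
          then show ?thesis by simp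
        qed
        then have qsub: "\<Union>(snd ` q) \<subseteq> {a..b}" "\<Union>(snd ` q) \<subseteq> U"
          by blast+
        \<comment> \<open>The intervals do not overlap and lie in \<open>U\<close>, so their total
          length is the integral of 1 over their union, at most the measure of
          \<open>U\<close>.\<close>
        have len: "(\<Sum>k\<in>snd ` q. Sup k - Inf k) < \<delta>"
        proof -
          have "(\<Sum>k\<in>snd ` q. Sup k - Inf k) = (\<Sum>k\<in>snd ` q. measure lborel k)"
            using * by (intro sum.cong) auto
          moreover have "((\<lambda>_. 1::real) has_integral (\<Sum>k\<in>snd ` q. measure lborel k)) (\<Union>(snd ` q))"
          proof (rule has_integral_combine_division[OF D])
            fix K assume "K \<in> snd ` q"
            then obtain u v where "K = cbox u v" using division_ofD(4)[OF D] by blast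
            then show "((\<lambda>_. 1::real) has_integral measure lborel K) K"
              using has_integral_const[of "1::real" u v] by simp
          qed
          moreover have "((\<lambda>_. 1::real) has_integral measure lebesgue U) U"
            using integrable_integral[of "\<lambda>_. 1::real" U] Um(1)
            by (simp add: lmeasurable_iff_integrable_on lmeasure_integral)
          ultimately have "(\<Sum>k\<in>snd ` q. Sup k - Inf k) \<le> measure lebesgue U"
            using has_integral_subset_le[OF qsub(2), of "\<lambda>_. 1::real"] by simp
          then show ?thesis using Um(2) by simp
        qed
        have qsum: "(\<Sum>(x,K)\<in>q. norm (f (Sup K) - f (Inf K))) < e * (b - a)"
        proof -
          \<comment> \<open>Passing from a sum over tagged intervals to a sum over intervals needs a
            summand that vanishes on degenerate boxes. \<open>F\<close> does so by definition, and
            it agrees with the increment of \<open>f\<close> on the intervals of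
            \<open>q\<close>.\<close>
          define F where "F = (\<lambda>K. if measure lborel K = 0 then 0 else norm (f (Sup K) - f (Inf K)))"
          have eq: "norm (f (Sup K) - f (Inf K)) = F K" if "(x, K) \<in> q" for x K
          proof -
            obtain u v where "K = {u..v}" "u \<le> v"
              using interval \<open>(x, K) \<in> q\<close> qp by (meson subsetD)
            then show ?thesis by (auto simp: F_def)
          qed
          have "(\<Sum>(x,K)\<in>q. norm (f (Sup K) - f (Inf K))) = (\<Sum>(x,K)\<in>q. F K)"
            using eq by (intro sum.cong) auto
          also have "\<dots> = (\<Sum>K\<in>snd ` q. F K)"
            by (rule sum.over_tagged_division_lemma[OF q]) (auto simp: F_def content_eq_0_interior)
          also have "\<dots> = (\<Sum>K\<in>snd ` q. norm (f (Sup K) - f (Inf K)))"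
            using eq by (intro sum.cong) auto
          also have "\<dots> < e * (b - a)"
            by (rule \<delta>[OF D qsub(1) len])
          finally show ?thesis .
        qed
        have "norm (measure lborel K *\<^sub>R h x - (f (Sup K) - f (Inf K)))
            \<le> e * (Sup K - Inf K) + (if x \<in> N then norm (f (Sup K) - f (Inf K)) else 0)"
          if xK: "(x, K) \<in> p" for x K
        proof -
          obtain u v where K: "K = {u..v}" "u \<le> v" "Sup K = v" "Inf K = u" "x \<in> {u..v}"
            and sub: "{u..v} \<subseteq> {a..b}" "{u..v} \<subseteq> ball x (d x)"
            using interval[OF xK] by blast
          show ?thesis
          proof (cases "x \<in> N")
            case True
            then show ?thesis using K \<open>e > 0\<close> by (simp add: h_def norm_minus_commute)
          next
            case False
            have uv: "u \<in> {u..v}" "v \<in> {u..v}" using K by auto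
            have x: "x \<in> {a..b}" using K sub by blast
            have close: "norm (u - x) < d x" "norm (v - x) < d x"
              using uv sub by (auto simp: subset_iff dist_real_def)
            \<comment> \<open>Both endpoints are compared with the tag. Since the tag lies between
              them, the two distances add up to exactly \<open>v - u\<close>.\<close>
            have "norm ((v - u) *\<^sub>R f' x - (f v - f u)) = norm (f u - f x - (u - x) *\<^sub>R f' x - (f v - f x - (v - x) *\<^sub>R f' x))"
              by (auto simp: algebra_simps)
            also have "\<dots> \<le> norm (f u - f x - (u - x) *\<^sub>R f' x) + norm (f v - f x - (v - x) *\<^sub>R f' x)"
              by (rule norm_triangle_ineq4)
            also have "\<dots> \<le> e * norm (u - x) + e * norm (v - x)"
              using uv sub by (intro add_mono d(3) x False close) auto
            also have "\<dots> = e * (v - u)"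
              using K by (simp add: algebra_simps)
            finally show ?thesis using K False by (simp add: h_def)
          qed
        qed
        then have "norm (\<Sum>(x, K) \<in> p. (measure lborel K *\<^sub>R h x) - (f (Sup K) - f (Inf K)))
          \<le> (\<Sum>(x, K)\<in>p. e * (Sup K - Inf K) + (if x \<in> N then norm (f (Sup K) - f (Inf K)) else 0))"
          by (intro sum_norm_le) auto
        also have "\<dots> = e * (b - a) + (\<Sum>(x, K)\<in>p. (if x \<in> N then norm (f (Sup K) - f (Inf K)) else 0))"
          by (simp add: ba sum.distrib split_def sum_distrib_left)
        also have "(\<Sum>(x, K)\<in>p. (if x \<in> N then norm (f (Sup K) - f (Inf K)) else 0)) = (\<Sum>(x,K)\<in>q. norm (f (Sup K) - f (Inf K)))"
          by (rule sum.mono_neutral_cong_right[OF fin qp]) (auto simp: q_def split: if_splits)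
        also have "e * (b - a) + \<dots> \<le> e0 * (b - a)"
          using qsum by (simp add: e_def field_simps)
        finally show "norm ((\<Sum>(x, K)\<in>p. measure lborel K *\<^sub>R h x) - (f b - f a)) \<le> e0 * measure lborel (cbox a b)"
          using \<open>a \<le> b\<close> by (simp add: ba split_def sum_subtractf [symmetric])
      qed
    qed
  qed
  then show ?thesis
    by (rule has_integral_spike[rotated 2, where S=N]) (use N in \<open>auto simp: h_def negligible_iff_null_sets\<close>)
qed

section \<open>Convex functions with Lipschitz gradient\<close>

lemma gderiv_chain:
  assumes "GDERIV g (y t) :> G" "(y has_vector_derivative y') (at t)"
  shows "((\<lambda>t. g (y t)) has_real_derivative y' \<bullet> G) (at t)"
proof -
  have "((\<lambda>t. g (y t)) has_derivative (\<lambda>h. (h *\<^sub>R y') \<bullet> G)) (at t)"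
    using assms has_derivative_compose unfolding gderiv_def has_vector_derivative_def by blast
  then show ?thesis
    by (simp add: has_field_derivative_def mult_commute_abs)
qed

text \<open>Restricting \<open>g\<close> to the line through \<open>y\<close> and \<open>z\<close>
  gives a convex function of one real variable, which lies above its tangent at 0.\<close>

lemma convex_gradient_ineq:
  fixes g :: "'a::real_inner \<Rightarrow> real"
  assumes convex: "convex_on UNIV g" and deriv: "GDERIV g y :> G"
  shows "g y + (z - y) \<bullet> G \<le> g z"
proof -
  define \<phi> where "\<phi> = (\<lambda>s. g (y + s *\<^sub>R (z - y)))"
  have "convex_on UNIV \<phi>"
  proof (rule convex_onI)
    fix t u v :: real
    assume "0 < t" "t < 1"
    moreover have "y + ((1 - t) *\<^sub>R u + t *\<^sub>R v) *\<^sub>R (z - y)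
      = (1 - t) *\<^sub>R (y + u *\<^sub>R (z - y)) + t *\<^sub>R (y + v *\<^sub>R (z - y))"
      by (simp add: algebra_simps)
    ultimately show "\<phi> ((1 - t) *\<^sub>R u + t *\<^sub>R v) \<le> (1 - t) * \<phi> u + t * \<phi> v"
      using convex_onD[OF convex, of t "y + u *\<^sub>R (z - y)" "y + v *\<^sub>R (z - y)"]
      by (simp add: \<phi>_def)
  qed auto
  moreover have "(\<phi> has_real_derivative (z - y) \<bullet> G) (at 0)"
    unfolding \<phi>_def
  proof (rule gderiv_chain)
    show "GDERIV g (y + 0 *\<^sub>R (z - y)) :> G" using deriv by simp
    show "((\<lambda>s. y + s *\<^sub>R (z - y)) has_vector_derivative z - y) (at 0)"
      by (auto intro!: derivative_eq_intros)
  qed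
  ultimately have "\<phi> 1 - \<phi> 0 \<ge> ((z - y) \<bullet> G) * (1 - 0)"
    by (intro convex_on_imp_above_tangent) auto
  then show ?thesis by (simp add: \<phi>_def)
qed

text \<open>The tangent at \<open>z\<close>, evaluated at \<open>y\<close>, bounds
  \<open>g z\<close> with \<open>G z\<close> in place of \<open>G y\<close>; the Lipschitz condition
  pays for the exchange. This avoids integrating along the segment, at the price of the constant
  \<open>L\<close> instead of \<open>L / 2\<close>.\<close>

lemma convex_descent_ineq:
  fixes g :: "'a::real_inner \<Rightarrow> real"
  assumes convex: "convex_on UNIV g" and deriv: "\<And>y. GDERIV g y :> G y"
    and lipschitz: "L-lipschitz_on UNIV G"
  shows "g z \<le> g y + (z - y) \<bullet> G y + L * (norm (z - y))\<^sup>2"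
proof -
  have "(z - y) \<bullet> (G z - G y) \<le> norm (z - y) * norm (G z - G y)"
    by (rule norm_cauchy_schwarz)
  also have "\<dots> \<le> norm (z - y) * (L * norm (z - y))"
    using lipschitz_onD[OF lipschitz, of z y] by (intro mult_left_mono) (auto simp: dist_norm)
  finally have "(z - y) \<bullet> (G z - G y) \<le> L * (norm (z - y))\<^sup>2"
    by (simp add: power2_eq_square algebra_simps)
  with convex_gradient_ineq[OF convex deriv, of z y] show ?thesis
    by (simp add: algebra_simps)
qed

text \<open>A gradient step from \<open>y\<close> lowers the value by at least |G y|^2 / (4 L), yet
  the value cannot fall below \<open>m\<close>.\<close>

lemma norm_gradient_sq_le:
  fixes g :: "'a::real_inner \<Rightarrow> real"
  assumes convex: "convex_on UNIV g" and deriv: "\<And>y. GDERIV g y :> G y"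
    and lipschitz: "L-lipschitz_on UNIV G" and "L > 0" and lower: "\<And>z. m \<le> g z"
  shows "(norm (G y))\<^sup>2 \<le> 4 * L * (g y - m)"
proof -
  \<comment> \<open>The step length 1 / (2 L) minimizes the quadratic upper bound along the
    direction of \<open>- G y\<close>.\<close>
  define z where "z = y - (1 / (2 * L)) *\<^sub>R G y"
  have "m \<le> g y + (z - y) \<bullet> G y + L * (norm (z - y))\<^sup>2"
    using convex_descent_ineq[OF convex deriv lipschitz] lower order_trans by blast
  also have "\<dots> = g y - (norm (G y))\<^sup>2 / (4 * L)"
    using \<open>L > 0\<close> by (simp add: z_def dot_square_norm field_simps power2_eq_square)
  finally show ?thesis
    using \<open>L > 0\<close> by (simp add: field_simps)
qed

section \<open>Integrability on a half-line\<close>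

text \<open>The integrals over \<open>{a..b}\<close> increase with \<open>b\<close> and stay below
  \<open>B\<close>, so they converge; for a nonnegative function this is absolute
  integrability.\<close>

lemma absolutely_integrable_on_atLeast:
  fixes f :: "real \<Rightarrow> real"
  assumes int: "\<And>b. f integrable_on {a..b}" and nonneg: "\<And>t. t \<ge> a \<Longrightarrow> f t \<ge> 0"
    and bound: "\<And>b. integral {a..b} f \<le> B"
  shows "f absolutely_integrable_on {a..}"
proof -
  have mono: "mono (\<lambda>b. integral {a..b} f)"
    by (simp add: int integral_subset_le monoI nonneg)
  obtain l where "(\<lambda>n. integral {a..real n} f) \<longlonglongrightarrow> l"
    using incseq_convergent[of "\<lambda>n. integral {a..real n} f" B] mono bound
    by (metis (no_types, lifting) monoD monoI of_nat_mono)
  then have "((\<lambda>b. integral {a..b} f) \<longlongrightarrow> l) at_top"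
    by (rule tendsto_at_topI_sequentially_real[OF mono])
  then have "f integrable_on {a..}"
    using has_integral_to_inf[OF int _ nonneg] by blast
  then show ?thesis
    using nonneg by (intro nonnegative_absolutely_integrable_1) auto
qed

section \<open>The energy and its rate of change\<close>

lemma has_real_derivative_inner:
  assumes "(f has_vector_derivative f') (at t within S)" "(g has_vector_derivative g') (at t within S)"
  shows "((\<lambda>t. f t \<bullet> g t) has_real_derivative f t \<bullet> g' + f' \<bullet> g t) (at t within S)"
  using bounded_bilinear.has_vector_derivative[OF bounded_bilinear_inner assms]
  by (simp add: has_real_derivative_iff_has_vector_derivative)

text \<open>Product and chain rules only: the acceleration \<open>a\<close> is arbitrary, and the
  differential equation enters later. Squared norms are written as inner products so that the
  product rule applies directly.\<close>

lemma energy_has_derivative: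
  fixes x x' :: "real \<Rightarrow> 'a::real_inner"
  assumes deriv: "\<And>y. GDERIV g y :> G y"
    and "t \<noteq> 0"
    and x: "(x has_vector_derivative x' t) (at t)" and x': "(x' has_vector_derivative a) (at t)"
  shows "((\<lambda>t. t\<^sup>2 * (g (x t + (\<gamma> + \<beta> / t) *\<^sub>R x' t) - m)
        + (l *\<^sub>R (x t - p) + t *\<^sub>R x' t) \<bullet> (l *\<^sub>R (x t - p) + t *\<^sub>R x' t) / 2
        + k * ((x t - p) \<bullet> (x t - p)) / 2)
      has_real_derivative
        2 * t * (g (x t + (\<gamma> + \<beta> / t) *\<^sub>R x' t) - m)
        + t\<^sup>2 * (((1 - \<beta> / t\<^sup>2) *\<^sub>R x' t + (\<gamma> + \<beta> / t) *\<^sub>R a) \<bullet> G (x t + (\<gamma> + \<beta> / t) *\<^sub>R x' t))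
        + (l *\<^sub>R (x t - p) + t *\<^sub>R x' t) \<bullet> ((l + 1) *\<^sub>R x' t + t *\<^sub>R a)
        + k * ((x t - p) \<bullet> x' t)) (at t)"
proof -
  have "((\<lambda>t. \<gamma> + \<beta> / t) has_real_derivative - (\<beta> / t\<^sup>2)) (at t)"
    using \<open>t \<noteq> 0\<close> by (auto intro!: derivative_eq_intros simp: power2_eq_square)
  from has_vector_derivative_add[OF x has_vector_derivative_scaleR[OF this x']]
  have y: "((\<lambda>t. x t + (\<gamma> + \<beta> / t) *\<^sub>R x' t) has_vector_derivative
      (1 - \<beta> / t\<^sup>2) *\<^sub>R x' t + (\<gamma> + \<beta> / t) *\<^sub>R a) (at t)"
    by (simp add: algebra_simps)
  have w: "((\<lambda>t. x t - p) has_vector_derivative x' t) (at t)"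
    using has_vector_derivative_diff[OF x has_vector_derivative_const[of p]] by simp
  have "((\<lambda>t. t *\<^sub>R x' t) has_vector_derivative t *\<^sub>R a + 1 *\<^sub>R x' t) (at t)"
    by (rule has_vector_derivative_scaleR[OF DERIV_ident x'])
  from has_vector_derivative_add[OF bounded_linear.has_vector_derivative[OF bounded_linear_scaleR_right w, of l] this]
  have z: "((\<lambda>t. l *\<^sub>R (x t - p) + t *\<^sub>R x' t) has_vector_derivative (l + 1) *\<^sub>R x' t + t *\<^sub>R a) (at t)"
    by (simp add: algebra_simps)
  show ?thesis
    by (rule derivative_eq_intros gderiv_chain[OF deriv y] has_real_derivative_inner[OF z z]
        has_real_derivative_inner[OF w w] refl | simp)+
      (simp add: inner_commute algebra_simps add_divide_distrib diff_divide_distrib)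
qed

text \<open>Here \<open>w\<close>, \<open>v\<close>, \<open>G\<close> and \<open>h\<close> stand for
  x - p, x', the gradient at y and g(y) - min g at one time \<open>t\<close>, and \<open>a\<close>
  is the acceleration given by the equation. What remains is algebra: \<open>l > 2\<close> gives the
  \<open>h\<close> terms the right sign, and half of the damping 2 c t |v|^2 is spent on the product
  of \<open>v\<close> and \<open>G\<close>.\<close>

lemma energy_rate_le:
  fixes w v G :: "'a::real_inner"
  assumes t: "t \<ge> 1" and \<alpha>: "\<alpha> > 3" and "0 \<le> h" and h: "h \<le> (w + b *\<^sub>R v) \<bullet> G"
    and b: "b = \<gamma> + \<beta> / t" and \<gamma>: "\<gamma> > 0"
    and l: "l = (\<alpha> + 1) / 2" and c: "c = (\<alpha> - 3) / 4"
    and C: "C = \<bar>\<beta>\<bar> + (\<alpha> - l) * (\<gamma> + \<bar>\<beta>\<bar>)"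
    and large: "C\<^sup>2 / (4 * c) + \<bar>\<beta>\<bar> \<le> \<gamma> * t"
    and a: "a = - ((\<alpha> / t) *\<^sub>R v + G)"
  shows "2 * t * h + t\<^sup>2 * (((1 - \<beta> / t\<^sup>2) *\<^sub>R v + b *\<^sub>R a) \<bullet> G)
        + (l *\<^sub>R w + t *\<^sub>R v) \<bullet> ((l + 1) *\<^sub>R v + t *\<^sub>R a)
        + l * (\<alpha> - 1 - l) * (w \<bullet> v) \<le> - (c * (t * (norm v)\<^sup>2))" (is "?D \<le> _")
proof -
  have "t > 0" using t by simp
  have "c > 0" using \<alpha> c by simp
  define \<kappa> where "\<kappa> = \<beta> + (\<alpha> - l) * (t * b)"
  have tb: "t * b = \<gamma> * t + \<beta>"
    using \<open>t > 0\<close> by (simp add: b field_simps)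
  \<comment> \<open>The weight l (\<alpha> - 1 - l) cancels the products of \<open>w\<close> and
    \<open>v\<close>, and the terms t^2 (v, G) cancel as well. Completing \<open>w\<close> to
    \<open>w + b v\<close>, which is y - p, turns \<alpha> into \<alpha> - l in
    \<open>\<kappa>\<close>.\<close>
  have D: "?D = 2 * t * h - l * t * ((w + b *\<^sub>R v) \<bullet> G) - \<kappa> * (v \<bullet> G)
      - t * (t * b) * (norm G)\<^sup>2 - 2 * (c * (t * (norm v)\<^sup>2))"
  proof -
    have e1: "t\<^sup>2 * (((1 - \<beta> / t\<^sup>2) *\<^sub>R v + b *\<^sub>R a) \<bullet> G)
      = (t\<^sup>2 - \<beta> - \<alpha> * (t * b)) * (v \<bullet> G) - t * (t * b) * (norm G)\<^sup>2"
      using \<open>t > 0\<close> by (simp add: a inner_simps dot_square_norm field_simps power2_eq_square)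
    have e2: "(l + 1) *\<^sub>R v + t *\<^sub>R a = (l + 1 - \<alpha>) *\<^sub>R v - t *\<^sub>R G"
      using \<open>t > 0\<close> by (simp add: a algebra_simps)
    have e3: "\<alpha> = 2 * c + 1 + l" by (simp add: c l field_simps)
    show ?thesis
      unfolding e1 e2 \<kappa>_def power2_norm_eq_inner e3
      by (simp add: inner_simps inner_commute algebra_simps power2_eq_square)
  qed
  have "2 * t * h - l * t * ((w + b *\<^sub>R v) \<bullet> G) \<le> 2 * t * h - l * t * h"
    using h \<alpha> \<open>t > 0\<close> l by (simp add: mult_left_mono)
  also have "\<dots> = - ((l - 2) * t * h)" by (simp add: algebra_simps)
  also have "\<dots> \<le> 0"
    using \<alpha> l \<open>t > 0\<close> \<open>0 \<le> h\<close> by simp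
  finally have 1: "2 * t * h - l * t * ((w + b *\<^sub>R v) \<bullet> G) \<le> 0" .
  have "\<bar>\<kappa>\<bar> \<le> C * t"
  proof -
    have "\<bar>\<beta>\<bar> \<le> \<bar>\<beta>\<bar> * t" using t by (simp add: mult_le_cancel_left1)
    moreover from this have "\<bar>t * b\<bar> \<le> (\<gamma> + \<bar>\<beta>\<bar>) * t"
      unfolding tb using abs_triangle_ineq[of "\<gamma> * t" \<beta>] \<gamma> t by (simp add: algebra_simps abs_mult)
    then have "\<bar>(\<alpha> - l) * (t * b)\<bar> \<le> (\<alpha> - l) * ((\<gamma> + \<bar>\<beta>\<bar>) * t)"
      using \<alpha> l by (simp add: abs_mult mult_left_mono)
    ultimately show ?thesis
      unfolding \<kappa>_def C by (simp add: algebra_simps)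
  qed
  then have "\<bar>\<kappa>\<bar> * \<bar>v \<bullet> G\<bar> \<le> C * t * (norm v * norm G)"
    by (intro mult_mono' Cauchy_Schwarz_ineq2) auto
  then have "- \<kappa> * (v \<bullet> G) \<le> C * t * (norm v * norm G)"
    using abs_ge_self[of "- \<kappa> * (v \<bullet> G)"] by (simp add: abs_mult)
  \<comment> \<open>Young's inequality, weighted so that the |v|^2 part takes exactly one of the two
    copies of c t |v|^2.\<close>
  also have "\<dots> \<le> t * (c * (norm v)\<^sup>2 + C\<^sup>2 / (4 * c) * (norm G)\<^sup>2)"
  proof -
    have "0 \<le> (2 * c * norm v - C * norm G)\<^sup>2 / (4 * c)"
      using \<open>c > 0\<close> by simp
    also have "\<dots> = c * (norm v)\<^sup>2 + C\<^sup>2 / (4 * c) * (norm G)\<^sup>2 - C * (norm v * norm G)"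
      using \<open>c > 0\<close> by (simp add: field_simps power2_eq_square)
    finally have "t * (C * (norm v * norm G)) \<le> t * (c * (norm v)\<^sup>2 + C\<^sup>2 / (4 * c) * (norm G)\<^sup>2)"
      using \<open>t > 0\<close> by (intro mult_left_mono) auto
      then show ?thesis by (simp add: mult.assoc mult.left_commute)
  qed
  \<comment> \<open>By \<open>large\<close>, the coefficient of |G|^2 is at most \<gamma> t -
    |\<beta>|, hence at most \<open>t * b\<close>.\<close>
  also have "\<dots> \<le> t * (c * (norm v)\<^sup>2 + (t * b) * (norm G)\<^sup>2)"
    using large \<open>t > 0\<close> unfolding tb
    by (intro mult_left_mono add_left_mono mult_right_mono) auto
  finally have 2: "- \<kappa> * (v \<bullet> G) \<le> t * (c * (norm v)\<^sup>2 + (t * b) * (norm G)\<^sup>2)" .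
  show ?thesis
    unfolding D using 1 2 by (simp add: algebra_simps)
qed

section \<open>Regularity of strong solutions\<close>

lemma abs_continuous_on_imp_continuous_on:
  assumes ac: "abs_continuous_on {a..b} f"
  shows "continuous_on {a..b} f"
  unfolding continuous_on_iff
proof (intro ballI allI impI)
  fix s e :: real
  assume s: "s \<in> {a..b}" and "e > 0"
  then obtain \<delta> where "\<delta> > 0" and \<delta>: "\<And>D. \<lbrakk>D division_of \<Union>D; \<Union>D \<subseteq> {a..b}; (\<Sum>k\<in>D. Sup k - Inf k) < \<delta>\<rbrakk>
      \<Longrightarrow> (\<Sum>k\<in>D. norm (f (Sup k) - f (Inf k))) < e"
    using abs_continuous_onE[OF ac] by blast
  have *: "norm (f v - f u) < e" if "u \<in> {a..b}" "v \<in> {a..b}" "u \<le> v" "v - u < \<delta>" for u v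
    using \<delta>[of "{{u..v}}"] that division_of_self[of u v] by auto
  have "dist (f t) (f s) < e" if "t \<in> {a..b}" "dist t s < \<delta>" for t
  proof (cases "s \<le> t")
    case True
    then show ?thesis using *[of s t] s that by (simp add: dist_norm)
  next
    case False
    then show ?thesis using *[of t s] s that by (simp add: dist_norm norm_minus_commute)
  qed
  with \<open>\<delta> > 0\<close> show "\<exists>d>0. \<forall>x'\<in>{a..b}. dist x' s < d \<longrightarrow> dist (f x') (f s) < e"
    by blast
qed

lemma strong_global_solution_has_vector_derivative:
  assumes sol: "strong_global_solution G \<alpha> \<beta> \<gamma> t0 u0 v0 x x'"
    and "t > t0"
  shows "(x has_vector_derivative x' t) (at t)"
proof -
  have "(x has_vector_derivative x' t) (at t within {t0..})"
    using assms unfolding strong_global_solution_def by simp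
  then have "(x has_vector_derivative x' t) (at t within {t0<..})"
    by (rule has_vector_derivative_within_subset) auto
  then show ?thesis
    using \<open>t > t0\<close> by (simp add: at_within_open[of _ "{t0<..}"])
qed

lemma strong_global_solution_continuous_on:
  assumes sol: "strong_global_solution G \<alpha> \<beta> \<gamma> t0 u0 v0 x x'"
  shows "continuous_on {t0..T} x" "continuous_on {t0..T} x'"
proof -
  \<comment> \<open>The right end exceeds both \<open>t0\<close> and \<open>T\<close>, which also
    covers \<open>T\<close> below \<open>t0\<close>.\<close>
  have "continuous_on {t0..T + \<bar>t0 - T\<bar> + 1} x" "continuous_on {t0..T + \<bar>t0 - T\<bar> + 1} x'"
    using sol unfolding strong_global_solution_def locally_abs_continuous_from_def
    by (auto intro!: abs_continuous_on_imp_continuous_on)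
  then show "continuous_on {t0..T} x" "continuous_on {t0..T} x'"
    by (auto elim!: continuous_on_subset)
qed

text \<open>The right-hand side of the equation is continuous in time, so the equation, assumed almost
  everywhere, holds everywhere.\<close>
lemma strong_global_solution_ode:
  assumes sol: "strong_global_solution G \<alpha> \<beta> \<gamma> t0 u0 v0 x x'"
    and "t0 > 0" and cont: "continuous_on UNIV G" and "t > t0"
  shows "(x' has_vector_derivative - ((\<alpha> / t) *\<^sub>R x' t + G (x t + (\<gamma> + \<beta> / t) *\<^sub>R x' t))) (at t)"
proof -
  define F where "F = (\<lambda>t. - ((\<alpha> / t) *\<^sub>R x' t + G (x t + (\<gamma> + \<beta> / t) *\<^sub>R x' t)))"
  note sol' = sol[unfolded strong_global_solution_def]
  define b where "b = t + 1"
  have contF: "continuous_on {t0..b} F"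
    unfolding F_def using \<open>t0 > 0\<close>
    by (intro continuous_intros continuous_on_compose2[OF cont] strong_global_solution_continuous_on[OF sol]) auto
  \<comment> \<open>Absolute continuity of \<open>x'\<close> makes its almost everywhere derivative
    determine it, so \<open>x'\<close> is a primitive of the continuous function
    \<open>F\<close>.\<close>
  have int: "integral {t0..s} F = x' s - x' t0" if "t0 < s" for s
  proof (rule integral_unique[OF abs_continuous_on_FTC])
    show "abs_continuous_on {t0..s} x'"
      using sol' that by (auto simp: locally_abs_continuous_from_def)
    from sol' have "AE t in lebesgue. t \<ge> t0 \<longrightarrow>
        (\<exists>x''. (x' has_vector_derivative x'') (at t within {t0..}) \<and>
           x'' + (\<alpha> / t) *\<^sub>R x' t + G (x t + (\<gamma> + \<beta> / t) *\<^sub>R x' t) = 0)" by blast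
    then show "AE t in lebesgue. t \<in> {t0..s} \<longrightarrow> (x' has_vector_derivative F t) (at t within {t0..s})"
    proof eventually_elim
      case (elim r)
      show ?case
      proof
        assume r: "r \<in> {t0..s}"
        with elim obtain x'' where "(x' has_vector_derivative x'') (at r within {t0..})"
          and "x'' + (\<alpha> / r) *\<^sub>R x' r + G (x r + (\<gamma> + \<beta> / r) *\<^sub>R x' r) = 0" by auto
        moreover from this(2) have "x'' = F r"
          by (simp only: F_def eq_neg_iff_add_eq_0 add.assoc)
        ultimately show "(x' has_vector_derivative F r) (at r within {t0..s})"
          by (auto intro: has_vector_derivative_within_subset)
      qed
    qed
  qed (use that in simp)
  have "((\<lambda>u. x' t0 + integral {t0..u} F) has_vector_derivative 0 + F t) (at t within {t0..b})"
    using \<open>t > t0\<close> by (intro derivative_intros integral_has_vector_derivative contF) (auto simp: b_def)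
  then have "((\<lambda>u. x' t0 + integral {t0..u} F) has_vector_derivative F t) (at t within {t0<..<b})"
    by (auto intro: has_vector_derivative_within_subset)
  then have "(x' has_vector_derivative F t) (at t within {t0<..<b})"
    by (rule has_vector_derivative_transform[rotated 2]) (use \<open>t > t0\<close> int in \<open>auto simp: b_def\<close>)
  moreover have "at t within {t0<..<b} = at t"
    using \<open>t > t0\<close> by (intro at_within_open) (auto simp: b_def)
  ultimately show ?thesis
    by (simp add: F_def)
qed

section \<open>Bounds and decay rates along the solution\<close>

lemma strong_global_solution_rates:
  fixes g :: "'a::euclidean_space \<Rightarrow> real"
  assumes convex: "convex_on UNIV g" and deriv: "\<And>y. GDERIV g y :> G y"
    and lipschitz: "L-lipschitz_on UNIV G" and min: "\<And>y. g p \<le> g y"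
    and "t0 > 0" and \<alpha>: "\<alpha> > 3" and "\<gamma> > 0"
    and sol: "strong_global_solution G \<alpha> \<beta> \<gamma> t0 u0 v0 x x'"
  shows "bounded (x ` {t0..})"
    and "\<exists>K\<ge>0. \<exists>t1\<ge>t0. \<forall>t\<ge>t1. norm (x' t) \<le> K / t"
    and "(\<lambda>t. t * (norm (x' t))\<^sup>2) absolutely_integrable_on {t0..}"
    and "\<exists>K\<ge>0. \<exists>t1\<ge>t0. \<forall>t\<ge>t1. g (x t) - g p \<le> K / t\<^sup>2"
proof -
  define l where "l = (\<alpha> + 1) / 2"
  define c where "c = (\<alpha> - 3) / 4"
  define k where "k = l * (\<alpha> - 1 - l)"
  define C where "C = \<bar>\<beta>\<bar> + (\<alpha> - l) * (\<gamma> + \<bar>\<beta>\<bar>)"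
  \<comment> \<open>From this time on \<open>t\<close> is at least 1, exceeds \<open>t0\<close>, and
    satisfies the largeness condition of \<open>energy_rate_le\<close>.\<close>
  define T where "T = t0 + 1 + (C\<^sup>2 / (4 * c) + \<bar>\<beta>\<bar>) / \<gamma>"
  define y where "y = (\<lambda>t. x t + (\<gamma> + \<beta> / t) *\<^sub>R x' t)"
  define z where "z = (\<lambda>t. l *\<^sub>R (x t - p) + t *\<^sub>R x' t)"
  define E where "E = (\<lambda>t. t\<^sup>2 * (g (y t) - g p) + z t \<bullet> z t / 2 + k * ((x t - p) \<bullet> (x t - p)) / 2)"
  have "c > 0" "l > 0" using \<alpha> by (simp_all add: c_def l_def)
  have "k > 0" using \<alpha> unfolding k_def l_def by (intro mult_pos_pos) (auto simp: field_simps)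
  have T0: "T > t0" "T \<ge> 1"
    using \<open>c > 0\<close> \<open>\<gamma> > 0\<close> \<open>t0 > 0\<close> by (auto simp: T_def intro!: add_pos_nonneg add_increasing2)
  have cont: "continuous_on UNIV G" by (rule lipschitz_on_continuous_on[OF lipschitz])
  have E_deriv: "\<exists>D. (E has_real_derivative D) (at t) \<and> D \<le> - (c * (t * (norm (x' t))\<^sup>2))"
    if "t \<ge> T" for t
  proof -
    have t: "t > t0" "t \<ge> 1" "t \<noteq> 0" using that T0 by auto
    have "g (y t) - g p \<le> ((x t - p) + (\<gamma> + \<beta> / t) *\<^sub>R x' t) \<bullet> G (y t)"
      using convex_gradient_ineq[OF convex deriv, of "y t" p]
      by (simp add: y_def inner_simps)
    moreover have "C\<^sup>2 / (4 * c) + \<bar>\<beta>\<bar> \<le> \<gamma> * t"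
    proof -
      have "(C\<^sup>2 / (4 * c) + \<bar>\<beta>\<bar>) / \<gamma> \<le> t" using that \<open>t0 > 0\<close> by (simp add: T_def)
      then show ?thesis using \<open>\<gamma> > 0\<close> by (simp add: field_simps)
    qed
    moreover have "0 \<le> g (y t) - g p" using min[of "y t"] by simp
    ultimately have rate: "2 * t * (g (y t) - g p)
        + t\<^sup>2 * (((1 - \<beta> / t\<^sup>2) *\<^sub>R x' t + (\<gamma> + \<beta> / t) *\<^sub>R (- ((\<alpha> / t) *\<^sub>R x' t + G (y t)))) \<bullet> G (y t))
        + (l *\<^sub>R (x t - p) + t *\<^sub>R x' t) \<bullet> ((l + 1) *\<^sub>R x' t + t *\<^sub>R (- ((\<alpha> / t) *\<^sub>R x' t + G (y t))))
        + k * ((x t - p) \<bullet> x' t) \<le> - (c * (t * (norm (x' t))\<^sup>2))"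
      unfolding k_def
      by (intro energy_rate_le[OF t(2) \<alpha> _ _ refl \<open>\<gamma> > 0\<close> l_def c_def C_def _ refl])
    show ?thesis
      unfolding E_def z_def y_def
      by (rule exI, rule conjI, rule energy_has_derivative[OF deriv t(3)
          strong_global_solution_has_vector_derivative[OF sol t(1)]
          strong_global_solution_ode[OF sol \<open>t0 > 0\<close> cont t(1)]])
        (rule rate[unfolded y_def])
  qed
  define I where "I = (\<lambda>t. integral {t0..t} (\<lambda>t. t * (norm (x' t))\<^sup>2))"
  have contI: "continuous_on {t0..b} (\<lambda>t. t * (norm (x' t))\<^sup>2)" for b
    by (intro continuous_intros strong_global_solution_continuous_on[OF sol])
  \<comment> \<open>Adding \<open>c * I\<close> accounts for the dissipated amount, so a single
    monotone quantity controls both the energy and the integral.\<close>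
  have decreasing: "E t + c * I t \<le> E T + c * I T" if "t \<ge> T" for t
  proof (rule DERIV_nonpos_imp_nonincreasing[OF that])
    fix s assume s: "T \<le> s" "s \<le> t"
    obtain D where D: "(E has_real_derivative D) (at s)" "D \<le> - (c * (s * (norm (x' s))\<^sup>2))"
      using E_deriv s by blast
    have "(I has_real_derivative s * (norm (x' s))\<^sup>2) (at s within {t0..s+1})"
      unfolding I_def using s T0
      by (intro integral_has_real_derivative contI) auto
    then have "(I has_real_derivative s * (norm (x' s))\<^sup>2) (at s within {t0<..<s+1})"
      by (rule DERIV_subset) auto
    then have "(I has_real_derivative s * (norm (x' s))\<^sup>2) (at s)"
      using s T0 by (simp add: at_within_open[of _ "{t0<..<s+1}"])
    with D have "((\<lambda>t. E t + c * I t) has_real_derivative D + c * (s * (norm (x' s))\<^sup>2)) (at s)"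
      by (auto intro!: derivative_eq_intros)
    with D(2) show "\<exists>y. ((\<lambda>t. E t + c * I t) has_real_derivative y) (at s) \<and> y \<le> 0"
      by (intro exI conjI) auto
  qed
  \<comment> \<open>As \<open>E\<close> and \<open>c * I\<close> are both nonnegative, each of them
    separately stays below \<open>B\<close> after \<open>T\<close>.\<close>
  define B where "B = E T + c * I T"
  have I_nonneg: "I t \<ge> 0" for t
    unfolding I_def using \<open>t0 > 0\<close>
    by (intro integral_nonneg integrable_continuous_real contI) auto
  have gap: "g (y t) - g p \<ge> 0" for t using min[of "y t"] by simp
  have E_nonneg: "E t \<ge> 0" for t
    unfolding E_def using gap[of t] \<open>k > 0\<close> by (intro add_nonneg_nonneg) auto
  have "B \<ge> 0" using E_nonneg I_nonneg \<open>c > 0\<close> by (simp add: B_def)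
  have E_le: "E t \<le> B" and I_le: "c * I t \<le> B" if "t \<ge> T" for t
    using decreasing[OF that] mult_nonneg_nonneg[OF less_imp_le[OF \<open>c > 0\<close>] I_nonneg[of t]] E_nonneg[of t]
    unfolding B_def by linarith+

  \<comment> \<open>\<open>R\<close> and \<open>Z\<close> come from bounding the second and third
    summands of \<open>E\<close> by \<open>B\<close> one at a time.\<close>
  define R where "R = sqrt (2 * B / k)"
  define Z where "Z = sqrt (2 * B)"
  have x_bound: "norm (x t - p) \<le> R" and z_bound: "norm (z t) \<le> Z"
    and gap_bound: "t\<^sup>2 * (g (y t) - g p) \<le> B" if "t \<ge> T" for t
  proof -
    have nonneg: "t\<^sup>2 * (g (y t) - g p) \<ge> 0" "z t \<bullet> z t / 2 \<ge> 0" "k * ((x t - p) \<bullet> (x t - p)) / 2 \<ge> 0"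
      using gap[of t] \<open>k > 0\<close> by auto
    then have *: "k * ((x t - p) \<bullet> (x t - p)) / 2 \<le> B" "z t \<bullet> z t / 2 \<le> B"
      and "t\<^sup>2 * (g (y t) - g p) \<le> B"
      using E_le[OF that] unfolding E_def by linarith+
    then show "t\<^sup>2 * (g (y t) - g p) \<le> B" by simp
    show "norm (x t - p) \<le> R"
      unfolding R_def norm_eq_sqrt_inner using *(1) \<open>k > 0\<close>
      by (intro real_sqrt_le_mono) (simp add: field_simps)
    show "norm (z t) \<le> Z"
      unfolding Z_def norm_eq_sqrt_inner using *(2)
      by (intro real_sqrt_le_mono) simp
  qed
  have "R \<ge> 0" "Z \<ge> 0" using \<open>B \<ge> 0\<close> \<open>k > 0\<close> by (simp_all add: R_def Z_def)

  have "bounded (x ` {t0..T})"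
    by (intro compact_imp_bounded compact_continuous_image strong_global_solution_continuous_on[OF sol]) auto
  moreover have "x ` {T..} \<subseteq> cball p R"
    using x_bound by (auto simp: dist_norm norm_minus_commute)
  then have "bounded (x ` {T..})" by (rule bounded_subset[OF bounded_cball])
  moreover have "{t0..} = {t0..T} \<union> {T..}" using T0 by auto
  ultimately show "bounded (x ` {t0..})"
    by (simp add: image_Un)

  \<comment> \<open>The velocity is recovered from t x' = z - l (x - p), whose two terms are bounded
    by \<open>Z\<close> and \<open>l * R\<close>.\<close>
  define K where "K = Z + l * R"
  have "K \<ge> 0" using \<open>R \<ge> 0\<close> \<open>Z \<ge> 0\<close> \<open>l > 0\<close> by (simp add: K_def)
  have x'_bound: "norm (x' t) \<le> K / t" if "t \<ge> T" for t
  proof -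
    have "t > 0" using that T0 by simp
    have "t *\<^sub>R x' t = z t - l *\<^sub>R (x t - p)" by (simp add: z_def)
    then have "t * norm (x' t) = norm (z t - l *\<^sub>R (x t - p))"
      using \<open>t > 0\<close> norm_scaleR[of t "x' t"] by simp
    also have "\<dots> \<le> norm (z t) + norm (l *\<^sub>R (x t - p))" by (rule norm_triangle_ineq4)
    also have "\<dots> \<le> K"
      unfolding K_def using z_bound[OF that] x_bound[OF that] \<open>l > 0\<close>
      by (intro add_mono) (auto intro: mult_left_mono)
    finally show ?thesis using \<open>t > 0\<close> by (simp add: field_simps)
  qed
  with \<open>K \<ge> 0\<close> T0 show "\<exists>K\<ge>0. \<exists>t1\<ge>t0. \<forall>t\<ge>t1. norm (x' t) \<le> K / t"
    by (intro exI[of _ K] exI[of _ T] conjI allI impI) auto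

  show "(\<lambda>t. t * (norm (x' t))\<^sup>2) absolutely_integrable_on {t0..}"
  proof (rule absolutely_integrable_on_atLeast)
    show int: "(\<lambda>t. t * (norm (x' t))\<^sup>2) integrable_on {t0..b}" for b
      by (intro integrable_continuous_real contI)
    show "integral {t0..b} (\<lambda>t. t * (norm (x' t))\<^sup>2) \<le> B / c" for b
    proof -
      \<comment> \<open>The bound on \<open>I\<close> holds only from \<open>T\<close> on; a shorter
        interval is enlarged, which the nonnegative integrand allows.\<close>
      have "integral {t0..b} (\<lambda>t. t * (norm (x' t))\<^sup>2) \<le> I (max b T)"
        unfolding I_def using int \<open>t0 > 0\<close>
        by (intro integral_subset_le) auto
      also have "\<dots> \<le> B / c"
        using I_le[of "max b T"] \<open>c > 0\<close> by (simp add: field_simps)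
      finally show ?thesis .
    qed
  qed (use \<open>t0 > 0\<close> in auto)

  \<comment> \<open>Bound for t |x - y|: the factor \<gamma> + \<beta> / t is at most \<gamma> +
    |\<beta>| in absolute value once \<open>t\<close> is at least 1.\<close>
  define M where "M = (\<gamma> + \<bar>\<beta>\<bar>) * K"
  have "M \<ge> 0" using \<open>K \<ge> 0\<close> \<open>\<gamma> > 0\<close> by (simp add: M_def)
  \<comment> \<open>\<open>L\<close> may be 0, while the gradient estimate divides by the Lipschitz
    constant.\<close>
  define L1 where "L1 = L + 1"
  have "L \<ge> 0" using lipschitz by (rule lipschitz_on_nonneg)
  then have "L1 > 0" and lip1: "L1-lipschitz_on UNIV G"
    using lipschitz_on_mono[OF lipschitz] by (auto simp: L1_def)
  \<comment> \<open>Bound for t |G y|, obtained from |G y|^2 <= 4 L1 (g y - g p) and the decay of g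
    y - g p.\<close>
  define N where "N = sqrt (4 * L1 * B)"
  have "N \<ge> 0" using \<open>B \<ge> 0\<close> \<open>L1 > 0\<close> by (simp add: N_def)
  have "g (x t) - g p \<le> (B + M * N + L1 * M\<^sup>2) / t\<^sup>2" if "t \<ge> T" for t
  proof -
    have t: "t \<ge> 1" "t > 0" using that T0 by auto
    have "t * norm (x t - y t) \<le> M"
    proof -
      have "\<bar>\<gamma> + \<beta> / t\<bar> \<le> \<gamma> + \<bar>\<beta>\<bar>"
      proof -
        have "\<bar>\<beta> / t\<bar> \<le> \<bar>\<beta>\<bar>" using t by (simp add: abs_div divide_le_eq mult_le_cancel_left1)
        then show ?thesis using \<open>\<gamma> > 0\<close> by linarith
      qed
      moreover have "t * norm (x' t) \<le> K"
        using x'_bound[OF that] t by (simp add: field_simps)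
      ultimately have "\<bar>\<gamma> + \<beta> / t\<bar> * (t * norm (x' t)) \<le> M"
        unfolding M_def using t by (intro mult_mono) auto
      moreover have "norm (x t - y t) = \<bar>\<gamma> + \<beta> / t\<bar> * norm (x' t)"
        unfolding y_def by (simp del: scaleR_add_left)
      ultimately show ?thesis by (simp add: mult.left_commute)
    qed
    moreover have "t * norm (G (y t)) \<le> N"
    proof -
      have "(t * norm (G (y t)))\<^sup>2 \<le> t\<^sup>2 * (4 * L1 * (g (y t) - g p))"
        unfolding power_mult_distrib
        by (intro mult_left_mono norm_gradient_sq_le[OF convex deriv lip1 \<open>L1 > 0\<close> min]) simp
      also have "\<dots> \<le> 4 * L1 * B"
        using gap_bound[OF that] \<open>L1 > 0\<close> by (simp add: mult_left_mono mult.left_commute)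
      finally show ?thesis unfolding N_def by (rule real_le_rsqrt)
    qed
    ultimately have "(t * norm (x t - y t)) * (t * norm (G (y t))) \<le> M * N"
      and "(t * norm (x t - y t))\<^sup>2 \<le> M\<^sup>2"
      using t \<open>M \<ge> 0\<close> \<open>N \<ge> 0\<close> by (auto intro!: mult_mono power_mono)
    \<comment> \<open>The descent inequality transfers the rate from \<open>y\<close> to
      \<open>x\<close>. After multiplication by t^2, one factor \<open>t\<close> goes to each norm,
      and every term is bounded.\<close>
    have "g (x t) - g p \<le> (g (y t) - g p) + norm (x t - y t) * norm (G (y t)) + L1 * (norm (x t - y t))\<^sup>2"
      using convex_descent_ineq[OF convex deriv lip1, of "x t" "y t"]
        norm_cauchy_schwarz[of "x t - y t" "G (y t)"] by linarith
    then have "t\<^sup>2 * (g (x t) - g p)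
      \<le> t\<^sup>2 * ((g (y t) - g p) + norm (x t - y t) * norm (G (y t)) + L1 * (norm (x t - y t))\<^sup>2)"
      by (rule mult_left_mono) simp
    then have *: "t\<^sup>2 * (g (x t) - g p) \<le> t\<^sup>2 * (g (y t) - g p) + (t * norm (x t - y t)) * (t * norm (G (y t)))
        + L1 * (t * norm (x t - y t))\<^sup>2"
      by (simp add: algebra_simps power2_eq_square)
    have "L1 * (t * norm (x t - y t))\<^sup>2 \<le> L1 * M\<^sup>2"
      using \<open>(t * norm (x t - y t))\<^sup>2 \<le> M\<^sup>2\<close> \<open>L1 > 0\<close> by simp
    with * have "t\<^sup>2 * (g (x t) - g p) \<le> B + M * N + L1 * M\<^sup>2"
      using gap_bound[OF that] \<open>(t * norm (x t - y t)) * (t * norm (G (y t))) \<le> M * N\<close> by linarith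
    then show ?thesis using t by (simp add: field_simps)
  qed
  moreover have "B + M * N + L1 * M\<^sup>2 \<ge> 0"
    using \<open>B \<ge> 0\<close> \<open>M \<ge> 0\<close> \<open>N \<ge> 0\<close> \<open>L1 > 0\<close> by simp
  ultimately show "\<exists>K\<ge>0. \<exists>t1\<ge>t0. \<forall>t\<ge>t1. g (x t) - g p \<le> K / t\<^sup>2"
    using T0 by (intro exI[of _ "B + M * N + L1 * M\<^sup>2"] exI[of _ T] conjI allI impI) auto
qed

theorem theorem16:
  fixes g :: "real ^ 'm \<Rightarrow> real"
    and G :: "real ^ 'm \<Rightarrow> real ^ 'm"
    and L\<^sub>g t0 \<alpha> \<beta> \<gamma> :: real
    and u0 v0 :: "real ^ 'm"
    and x x' :: "real \<Rightarrow> real ^ 'm"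
  assumes "convex_on UNIV g"
    and "\<And>y. GDERIV g y :> G y"
    and "lipschitz_on L\<^sub>g UNIV G"
    and "{p. is_arg_min g (\<lambda>y. True) p} \<noteq> {}"
    and "t0 > 0" and "\<alpha> > 3" and "\<gamma> > 0"
    and "strong_global_solution G \<alpha> \<beta> \<gamma> t0 u0 v0 x x'"
  shows "bounded (x ` {t0..}) \<and>
    (\<exists>K\<ge>0. \<exists>t1\<ge>t0. \<forall>t\<ge>t1. norm (x' t) \<le> K / t) \<and>
    set_integrable lebesgue {t0..} (\<lambda>t. t * (norm (x' t))\<^sup>2) \<and>
    (\<exists>K1\<ge>0. \<exists>t2\<ge>t0. \<forall>t\<ge>t2. g (x t) - g (arg_min g (\<lambda>y. True)) \<le> K1 / t\<^sup>2)"
proof -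
  \<comment> \<open>\<open>arg_min\<close> is a choice operator; since a minimizer exists, the
    chosen point is one and can serve as \<open>p\<close>.\<close>
  have "is_arg_min g (\<lambda>y. True) (arg_min g (\<lambda>y. True))"
    using assms(4) unfolding arg_min_def by (auto intro: someI)
  then have "g (arg_min g (\<lambda>y. True)) \<le> g y" for y
    by (simp add: is_arg_min_linorder)
  from strong_global_solution_rates[OF assms(1-3) this assms(5-8)]
  show ?thesis by blast
qed

end
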